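(* Let $k\in\mathbb{Z}$. The representation $\mu':L_n\longrightarrow \mathrm{GL}_n(\mathbb{Z}[t^{\pm1}])$ of the triplet group $L_n$ is faithful for $n=2$ and $n=3$, and unfaithful for all $n\ge 4$.
   Context: The triplet group $L_n$ is the group generated by $\ell_1,\ldots,\ell_{n-1}$ subject to the relations $\ell_i^2=1$ for $1\le i\le n-1$ and $\ell_i\ell_{i+1}\ell_i=\ell_{i+1}\ell_i\ell_{i+1}$ for $1\le i\le n-2$ (no commutation relations are imposed). Let $t$ be an indeterminate and $k\in\mathbb{Z}$ a fixed integer. The representation $\mu':L_n\to \mathrm{GL}_n(\mathbb{Z}[t^{\pm1}])$ ($n\ge2$) sends each generator $\ell_i$, $1\le i\le n-1$, to the block matrix \[ \begin{pmatrix} I_{i-1} & 0 & 0 \\ 0 & \begin{pmatrix} 0 & t^k \\ t^{-k} & 0 \end{pmatrix} & 0 \\ 0 & 0 & I_{n-i-1} \end{pmatrix}, \] where $I_r$ is the $r\times r$ identity matrix. A representation is faithful if it is injective. *)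

theory Defs
  imports
    "HOL-Algebra.Algebra"
    "HOL-Library.Poly_Mapping"
    "Jordan_Normal_Form.Matrix"
begin

section \<open>Group presentations\<close>

text \<open>The letter \<open>(a, True)\<close> stands for the generator \<open>a\<close>, and \<open>(a, False)\<close> for its formal
  inverse.  A relation \<open>u = v\<close> is the pair \<open>(u, v)\<close>.\<close>

type_synonym 'a gword = "('a \<times> bool) list"

definition gwords :: "'a set \<Rightarrow> 'a gword set" where
  "gwords S = lists (S \<times> UNIV)"

inductive pres_cong :: "'a set \<Rightarrow> ('a gword \<times> 'a gword) set \<Rightarrow> 'a gword \<Rightarrow> 'a gword \<Rightarrow> bool"
  for S R where
  refl: "w \<in> gwords S \<Longrightarrow> pres_cong S R w w"
| sym: "pres_cong S R u v \<Longrightarrow> pres_cong S R v u"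
| trans: "pres_cong S R u v \<Longrightarrow> pres_cong S R v w \<Longrightarrow> pres_cong S R u w"
| cancel: "x \<in> gwords S \<Longrightarrow> y \<in> gwords S \<Longrightarrow> a \<in> S \<Longrightarrow>
    pres_cong S R (x @ [(a, b), (a, \<not> b)] @ y) (x @ y)"
| rel: "x \<in> gwords S \<Longrightarrow> y \<in> gwords S \<Longrightarrow> (u, v) \<in> R \<Longrightarrow> u \<in> gwords S \<Longrightarrow> v \<in> gwords S \<Longrightarrow>
    pres_cong S R (x @ u @ y) (x @ v @ y)"

definition pres_rel :: "'a set \<Rightarrow> ('a gword \<times> 'a gword) set \<Rightarrow> ('a gword \<times> 'a gword) set" where
  "pres_rel S R = {(u, v). pres_cong S R u v}"

definition presented_group :: "'a set \<Rightarrow> ('a gword \<times> 'a gword) set \<Rightarrow> 'a gword set monoid" where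
  "presented_group S R =
    \<lparr>carrier = gwords S // pres_rel S R,
     monoid.mult = (\<lambda>A B. \<Union>u\<in>A. \<Union>v\<in>B. pres_rel S R `` {u @ v}),
     one = pres_rel S R `` {[]}\<rparr>"

definition presented_gen :: "'a set \<Rightarrow> ('a gword \<times> 'a gword) set \<Rightarrow> 'a \<Rightarrow> 'a gword set" where
  "presented_gen S R a = pres_rel S R `` {[(a, True)]}"

text \<open>The homomorphism out of a presented group determined by the images \<open>f a\<close> of the
  generators; \<open>presented_lift_hom\<close> and \<open>presented_lift_gen\<close> below show that it is one whenever
  \<open>f\<close> respects the relations, and \<open>presented_lift_unique\<close> that it is the only one.\<close>

definition eval_letter :: "('b, 'm) monoid_scheme \<Rightarrow> ('a \<Rightarrow> 'b) \<Rightarrow> 'a \<times> bool \<Rightarrow> 'b" where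
  "eval_letter G f l = (if snd l then f (fst l) else inv\<^bsub>G\<^esub> (f (fst l)))"

definition eval_gword :: "('b, 'm) monoid_scheme \<Rightarrow> ('a \<Rightarrow> 'b) \<Rightarrow> 'a gword \<Rightarrow> 'b" where
  "eval_gword G f w = foldr (\<lambda>l x. eval_letter G f l \<otimes>\<^bsub>G\<^esub> x) w \<one>\<^bsub>G\<^esub>"

definition presented_lift :: "('b, 'm) monoid_scheme \<Rightarrow> ('a \<Rightarrow> 'b) \<Rightarrow> 'a gword set \<Rightarrow> 'b" where
  "presented_lift G f = (\<lambda>W. the_elem (eval_gword G f ` W))"

lemma gwords_simps [simp]:
  "[] \<in> gwords S"
  "l # w \<in> gwords S \<longleftrightarrow> fst l \<in> S \<and> w \<in> gwords S"
  "u @ v \<in> gwords S \<longleftrightarrow> u \<in> gwords S \<and> v \<in> gwords S"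
  by (auto simp: gwords_def mem_Times_iff)

lemma pres_cong_gwords: "pres_cong S R u v \<Longrightarrow> u \<in> gwords S \<and> v \<in> gwords S"
  by (induction rule: pres_cong.induct) auto

lemma equiv_pres_rel: "equiv (gwords S) (pres_rel S R)"
  by (rule equivI)
    (auto simp: pres_rel_def refl_on_def sym_def trans_def
      intro: pres_cong.intros dest: pres_cong_gwords)

lemma pres_cong_context:
  assumes "pres_cong S R u v" "x \<in> gwords S" "y \<in> gwords S"
  shows "pres_cong S R (x @ u @ y) (x @ v @ y)"
  using assms
proof (induction rule: pres_cong.induct)
  case (cancel p q a b)
  then show ?case using pres_cong.cancel[of "x @ p" S "q @ y" a R b] by simp
next
  case (rel p q u v)
  then show ?case using pres_cong.rel[of "x @ p" S "q @ y" u v R] by simp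
qed (auto intro: pres_cong.intros)

lemma pres_cong_append:
  assumes "pres_cong S R u u'" "pres_cong S R v v'"
  shows "pres_cong S R (u @ v) (u' @ v')"
  using pres_cong_context[OF assms(1), of "[]" v] pres_cong_context[OF assms(2), of u' "[]"]
    pres_cong_gwords[OF assms(1)] pres_cong_gwords[OF assms(2)]
  by (auto intro: pres_cong.trans)

lemma presented_mult:
  assumes "u \<in> gwords S" "v \<in> gwords S"
  shows "pres_rel S R `` {u} \<otimes>\<^bsub>presented_group S R\<^esub> pres_rel S R `` {v} = pres_rel S R `` {u @ v}"
proof -
  have "congruent2 (pres_rel S R) (pres_rel S R) (\<lambda>u v. pres_rel S R `` {u @ v})"
    by (auto simp: congruent2_def intro!: equiv_class_eq[OF equiv_pres_rel])
      (auto simp: pres_rel_def intro: pres_cong_append)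
  then show ?thesis
    using UN_equiv_class2[OF equiv_pres_rel equiv_pres_rel _ assms]
    by (simp add: presented_group_def)
qed

lemma presented_carrierE:
  assumes "A \<in> carrier (presented_group S R)"
  obtains u where "u \<in> gwords S" "A = pres_rel S R `` {u}"
  using assms by (auto simp: presented_group_def elim: quotientE)

lemma presented_carrierI: "u \<in> gwords S \<Longrightarrow> pres_rel S R `` {u} \<in> carrier (presented_group S R)"
  by (auto simp: presented_group_def intro: quotientI)

lemma presented_one: "\<one>\<^bsub>presented_group S R\<^esub> = pres_rel S R `` {[]}"
  by (simp add: presented_group_def)

lemma pres_cong_inverse:
  assumes "u \<in> gwords S"
  shows "pres_cong S R (map (\<lambda>(a, b). (a, \<not> b)) (rev u) @ u) []"
  using assms
proof (induction u)
  case Nil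
  then show ?case by (auto intro: pres_cong.refl)
next
  case (Cons l u)
  obtain a b where l: "l = (a, b)" by (cases l)
  let ?i = "map (\<lambda>(a, b). (a, \<not> b)) (rev u)"
  have i: "?i \<in> gwords S" using Cons.prems by (auto simp: gwords_def)
  have "pres_cong S R (?i @ [(a, \<not> b), (a, \<not> \<not> b)] @ u) (?i @ u)"
    using Cons.prems i by (intro pres_cong.cancel) (auto simp: l)
  then show ?case using Cons by (auto simp: l intro: pres_cong.trans)
qed

lemma group_presented_group: "group (presented_group S R)"
proof (rule groupI)
  fix A B assume "A \<in> carrier (presented_group S R)" "B \<in> carrier (presented_group S R)"
  then show "A \<otimes>\<^bsub>presented_group S R\<^esub> B \<in> carrier (presented_group S R)"
    by (auto elim!: presented_carrierE simp: presented_mult intro!: presented_carrierI)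
next
  show "\<one>\<^bsub>presented_group S R\<^esub> \<in> carrier (presented_group S R)"
    by (simp add: presented_one presented_carrierI)
next
  fix A B C assume "A \<in> carrier (presented_group S R)" "B \<in> carrier (presented_group S R)"
    "C \<in> carrier (presented_group S R)"
  then show "A \<otimes>\<^bsub>presented_group S R\<^esub> B \<otimes>\<^bsub>presented_group S R\<^esub> C =
    A \<otimes>\<^bsub>presented_group S R\<^esub> (B \<otimes>\<^bsub>presented_group S R\<^esub> C)"
    by (auto elim!: presented_carrierE simp: presented_mult)
next
  fix A assume "A \<in> carrier (presented_group S R)"
  then show "\<one>\<^bsub>presented_group S R\<^esub> \<otimes>\<^bsub>presented_group S R\<^esub> A = A"
    by (auto elim!: presented_carrierE simp: presented_mult presented_one)
next
  fix A assume "A \<in> carrier (presented_group S R)"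
  then obtain u where u: "u \<in> gwords S" "A = pres_rel S R `` {u}" by (rule presented_carrierE)
  let ?i = "map (\<lambda>(a, b). (a, \<not> b)) (rev u)"
  have i: "?i \<in> gwords S" using u(1) by (auto simp: gwords_def)
  have "pres_rel S R `` {?i} \<otimes>\<^bsub>presented_group S R\<^esub> A = pres_rel S R `` {[]}"
    unfolding u(2) presented_mult[OF i u(1)]
    by (rule equiv_class_eq[OF equiv_pres_rel]) (simp add: pres_rel_def pres_cong_inverse u(1))
  then show "\<exists>B\<in>carrier (presented_group S R). B \<otimes>\<^bsub>presented_group S R\<^esub> A = \<one>\<^bsub>presented_group S R\<^esub>"
    using presented_carrierI[OF i] by (auto simp: presented_one)
qed

context group
begin

lemma eval_gword_closed:
  assumes "f \<in> S \<rightarrow> carrier G" "w \<in> gwords S"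
  shows "eval_gword G f w \<in> carrier G"
  using assms(2) by (induction w) (use assms(1) in \<open>auto simp: eval_gword_def eval_letter_def\<close>)

lemma eval_gword_append:
  assumes "f \<in> S \<rightarrow> carrier G" "u \<in> gwords S" "v \<in> gwords S"
  shows "eval_gword G f (u @ v) = eval_gword G f u \<otimes> eval_gword G f v"
  using assms(2)
proof (induction u)
  case Nil
  then show ?case using eval_gword_closed[OF assms(1,3)] by (simp add: eval_gword_def)
next
  case (Cons l u)
  have l: "eval_letter G f l \<in> carrier G"
    using assms(1) Cons.prems by (auto simp: eval_letter_def)
  have "eval_gword G f ((l # u) @ v) = eval_letter G f l \<otimes> eval_gword G f (u @ v)"
    by (simp add: eval_gword_def)
  also have "\<dots> = eval_letter G f l \<otimes> (eval_gword G f u \<otimes> eval_gword G f v)"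
    using Cons by simp
  also have "\<dots> = eval_letter G f l \<otimes> eval_gword G f u \<otimes> eval_gword G f v"
    using l Cons.prems assms by (simp add: m_assoc eval_gword_closed)
  finally show ?case by (simp add: eval_gword_def)
qed

lemma eval_gword_cong:
  assumes f: "f \<in> S \<rightarrow> carrier G"
    and R: "\<And>u v. (u, v) \<in> R \<Longrightarrow> eval_gword G f u = eval_gword G f v"
    and "pres_cong S R u v"
  shows "eval_gword G f u = eval_gword G f v"
  using assms(3)
proof (induction rule: pres_cong.induct)
  case (cancel x y a b)
  have "f a \<in> carrier G" using f cancel by auto
  then have "eval_gword G f [(a, b), (a, \<not> b)] = \<one>"
    by (auto simp: eval_gword_def eval_letter_def)
  moreover have "[(a, b), (a, \<not> b)] \<in> gwords S" using cancel by auto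
  ultimately show ?case using cancel eval_gword_closed[OF f]
    by (simp add: eval_gword_append[OF f] del: append_Cons gwords_simps(2))
next
  case (rel x y u v)
  then show ?case using R[OF rel(3)] by (simp add: eval_gword_append[OF f])
qed auto

lemma presented_lift_class:
  assumes f: "f \<in> S \<rightarrow> carrier G"
    and R: "\<And>u v. (u, v) \<in> R \<Longrightarrow> eval_gword G f u = eval_gword G f v"
    and u: "u \<in> gwords S"
  shows "presented_lift G f (pres_rel S R `` {u}) = eval_gword G f u"
proof -
  have "eval_gword G f ` (pres_rel S R `` {u}) = {eval_gword G f u}"
  proof (intro equalityI subsetI)
    fix x assume "x \<in> eval_gword G f ` (pres_rel S R `` {u})"
    then obtain v where v: "pres_cong S R u v" "x = eval_gword G f v"
      by (auto simp: pres_rel_def)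
    then show "x \<in> {eval_gword G f u}" using eval_gword_cong[OF f R v(1)] by simp
  next
    fix x assume "x \<in> {eval_gword G f u}"
    moreover have "u \<in> pres_rel S R `` {u}" using pres_cong.refl[OF u] by (simp add: pres_rel_def)
    ultimately show "x \<in> eval_gword G f ` (pres_rel S R `` {u})" by blast
  qed
  then show ?thesis by (simp add: presented_lift_def)
qed

lemma presented_lift_hom:
  assumes f: "f \<in> S \<rightarrow> carrier G"
    and R: "\<And>u v. (u, v) \<in> R \<Longrightarrow> eval_gword G f u = eval_gword G f v"
  shows "presented_lift G f \<in> hom (presented_group S R) G"
  by (rule homI)
    (auto elim!: presented_carrierE
      simp: presented_mult presented_lift_class[OF assms] eval_gword_append[OF f] eval_gword_closed[OF f])

lemma presented_lift_gen:
  assumes f: "f \<in> S \<rightarrow> carrier G"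
    and R: "\<And>u v. (u, v) \<in> R \<Longrightarrow> eval_gword G f u = eval_gword G f v"
    and a: "a \<in> S"
  shows "presented_lift G f (presented_gen S R a) = f a"
proof -
  have "f a \<in> carrier G" using f a by auto
  then show ?thesis
    unfolding presented_gen_def using a
    by (subst presented_lift_class[OF f R]) (auto simp: eval_gword_def eval_letter_def)
qed

lemma presented_lift_unique:
  assumes f: "f \<in> S \<rightarrow> carrier G"
    and R: "\<And>u v. (u, v) \<in> R \<Longrightarrow> eval_gword G f u = eval_gword G f v"
    and h: "h \<in> hom (presented_group S R) G"
    and hf: "\<And>a. a \<in> S \<Longrightarrow> h (presented_gen S R a) = f a"
    and A: "A \<in> carrier (presented_group S R)"
  shows "h A = presented_lift G f A"
proof -
  interpret P: group "presented_group S R" by (rule group_presented_group)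
  interpret h: group_hom "presented_group S R" G h
    using h by unfold_locales
  have letter: "h (pres_rel S R `` {[l]}) = eval_letter G f l" if l: "fst l \<in> S" for l
  proof (cases "snd l")
    case True
    then have "l = (fst l, True)" by (cases l) auto
    then show ?thesis using hf[OF l] True by (simp add: presented_gen_def eval_letter_def)
  next
    case False
    then have ll: "l = (fst l, False)" by (cases l) auto
    have "pres_cong S R ([] @ [(fst l, False), (fst l, \<not> False)] @ []) ([] @ [])"
      using l by (intro pres_cong.cancel) auto
    then have "pres_rel S R `` {[l] @ [(fst l, True)]} = pres_rel S R `` {[]}"
      by (intro equiv_class_eq[OF equiv_pres_rel]) (subst ll, simp add: pres_rel_def)
    then have "pres_rel S R `` {[l]} \<otimes>\<^bsub>presented_group S R\<^esub> presented_gen S R (fst l)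
        = \<one>\<^bsub>presented_group S R\<^esub>"
      unfolding presented_gen_def using l by (subst presented_mult) (auto simp: presented_one)
    moreover have "pres_rel S R `` {[l]} \<in> carrier (presented_group S R)"
      "presented_gen S R (fst l) \<in> carrier (presented_group S R)"
      using l by (auto simp: presented_gen_def intro: presented_carrierI)
    ultimately have "pres_rel S R `` {[l]} = inv\<^bsub>presented_group S R\<^esub> presented_gen S R (fst l)"
      by (metis P.inv_equality)
    then show ?thesis
      using \<open>presented_gen S R (fst l) \<in> _\<close> hf[OF l] False by (simp add: eval_letter_def)
  qed
  have "h (pres_rel S R `` {u}) = eval_gword G f u" if "u \<in> gwords S" for u
    using that
  proof (induction u)
    case Nil
    then show ?case using h.hom_one by (simp add: presented_one eval_gword_def)
  next
    case (Cons l u)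
    have "pres_rel S R `` {l # u} = pres_rel S R `` {[l]} \<otimes>\<^bsub>presented_group S R\<^esub> pres_rel S R `` {u}"
      using Cons.prems by (subst presented_mult) auto
    moreover have "pres_rel S R `` {[l]} \<in> carrier (presented_group S R)"
      "pres_rel S R `` {u} \<in> carrier (presented_group S R)"
      using Cons.prems by (auto intro: presented_carrierI)
    ultimately show ?case
      using Cons letter[of l] by (simp add: eval_gword_def)
  qed
  with A show ?thesis
    by (auto elim!: presented_carrierE simp: presented_lift_class[OF f R])
qed

end

section \<open>Triplet groups\<close>

definition triplet_gens :: "nat \<Rightarrow> nat set" where
  "triplet_gens n = {i. 1 \<le> i \<and> i \<le> n - 1}"

definition triplet_rels :: "nat \<Rightarrow> (nat gword \<times> nat gword) set" where
  "triplet_rels n =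
    {([(i, True), (i, True)], []) | i. 1 \<le> i \<and> i \<le> n - 1} \<union>
    {([(i, True), (i + 1, True), (i, True)], [(i + 1, True), (i, True), (i + 1, True)])
      | i. 1 \<le> i \<and> i \<le> n - 2}"

definition triplet_group :: "nat \<Rightarrow> nat gword set monoid" where
  "triplet_group n = presented_group (triplet_gens n) (triplet_rels n)"

definition triplet_gen :: "nat \<Rightarrow> nat \<Rightarrow> nat gword set" where
  "triplet_gen n i = presented_gen (triplet_gens n) (triplet_rels n) i"

section \<open>The representation\<close>

text \<open>The Laurent polynomial ring in \<open>t\<close> over the integers is the group ring of the additive
  group of integers: finitely supported maps from exponents to coefficients, with convolution
  as product.\<close>

type_synonym laurent = "int \<Rightarrow>\<^sub>0 int"

definition tpow :: "int \<Rightarrow> laurent" where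
  "tpow k = Poly_Mapping.single k 1"

lemma tpow_0: "tpow 0 = 1"
  by (simp add: tpow_def)

lemma tpow_add: "tpow (j + k) = tpow j * tpow k"
  by (simp add: tpow_def mult_single)

definition GL_laurent :: "nat \<Rightarrow> laurent mat monoid" where
  "GL_laurent n = units_of (ring_mat TYPE(laurent) n ())"

definition mu_gen :: "int \<Rightarrow> nat \<Rightarrow> nat \<Rightarrow> laurent mat" where
  "mu_gen k n i = diag_block_mat
    [1\<^sub>m (i - 1), mat_of_rows_list 2 [[0, tpow k], [tpow (- k), 0]], 1\<^sub>m (n - i - 1)]"

definition mu' :: "int \<Rightarrow> nat \<Rightarrow> nat gword set \<Rightarrow> laurent mat" where
  "mu' k n = presented_lift (GL_laurent n) (mu_gen k n)"

definition faithful :: "('a, 'm) monoid_scheme \<Rightarrow> ('a \<Rightarrow> 'b) \<Rightarrow> bool" where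
  "faithful G \<phi> \<longleftrightarrow> inj_on \<phi> (carrier G)"

lemma group_triplet_group: "group (triplet_group n)"
  by (simp add: triplet_group_def group_presented_group)

lemma group_GL_laurent: "group (GL_laurent n)"
proof -
  interpret ring "ring_mat TYPE(laurent) n ()" by (rule ring_mat)
  show ?thesis by (simp add: GL_laurent_def units_group)
qed

definition monomial_mat :: "nat \<Rightarrow> (nat \<Rightarrow> nat) \<Rightarrow> (nat \<Rightarrow> 'a) \<Rightarrow> 'a :: comm_ring_1 mat" where
  "monomial_mat n s w = mat n n (\<lambda>(r, c). if c = s r then w r else 0)"

lemma monomial_mat_mult:
  assumes "\<And>r. r < n \<Longrightarrow> s r < n"
  shows "monomial_mat n s w * monomial_mat n s' w' = monomial_mat n (s' \<circ> s) (\<lambda>r. w r * w' (s r))"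
proof (rule eq_matI)
  fix r c assume "r < dim_row (monomial_mat n (s' \<circ> s) (\<lambda>r. w r * w' (s r)))"
    "c < dim_col (monomial_mat n (s' \<circ> s) (\<lambda>r. w r * w' (s r)))"
  then have rc: "r < n" "c < n" by (auto simp: monomial_mat_def)
  have "(monomial_mat n s w * monomial_mat n s' w') $$ (r, c) =
    (\<Sum>j\<in>{0..<n}. (if j = s r then w r else 0) * (if c = s' j then w' j else 0))"
    using rc by (auto simp: monomial_mat_def scalar_prod_def intro!: sum.cong)
  also have "\<dots> = (\<Sum>j\<in>{0..<n}. if j = s r then w r * (if c = s' j then w' j else 0) else 0)"
    by (rule sum.cong) auto
  also have "\<dots> = (if c = s' (s r) then w r * w' (s r) else 0)"
    using assms[OF rc(1)] by simp
  finally show "(monomial_mat n s w * monomial_mat n s' w') $$ (r, c) =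
    monomial_mat n (s' \<circ> s) (\<lambda>r. w r * w' (s r)) $$ (r, c)"
    using rc by (simp add: monomial_mat_def)
qed (auto simp: monomial_mat_def)

lemma monomial_mat_cong:
  assumes "\<And>r. r < n \<Longrightarrow> s r = s' r" "\<And>r. r < n \<Longrightarrow> w r = w' r"
  shows "monomial_mat n s w = monomial_mat n s' w'"
  using assms by (intro eq_matI) (auto simp: monomial_mat_def)

lemma one_mat_monomial: "1\<^sub>m n = monomial_mat n id (\<lambda>_. 1)"
  by (intro eq_matI) (auto simp: monomial_mat_def)

definition mu_perm :: "nat \<Rightarrow> nat \<Rightarrow> nat" where
  "mu_perm i r = (if r = i - 1 then i else if r = i then i - 1 else r)"

definition mu_weight :: "int \<Rightarrow> nat \<Rightarrow> nat \<Rightarrow> laurent" where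
  "mu_weight k i r = (if r = i - 1 then tpow k else if r = i then tpow (- k) else 1)"

lemma mu_gen_monomial:
  assumes "i \<in> triplet_gens n"
  shows "mu_gen k n i = monomial_mat n (mu_perm i) (mu_weight k i)"
proof -
  have i: "1 \<le> i" "i < n" using assms by (auto simp: triplet_gens_def)
  show ?thesis
  proof (rule eq_matI)
    fix r c assume "r < dim_row (monomial_mat n (mu_perm i) (mu_weight k i))"
      "c < dim_col (monomial_mat n (mu_perm i) (mu_weight k i))"
    then have rc: "r < n" "c < n" by (auto simp: monomial_mat_def)
    define B where "B = mat_of_rows_list 2 [[0, tpow k], [tpow (- k), 0]]"
    have B: "dim_row B = 2" "dim_col B = 2" "B $$ (0, 0) = 0" "B $$ (0, Suc 0) = tpow k"
      "B $$ (Suc 0, 0) = tpow (- k)" "B $$ (Suc 0, Suc 0) = 0"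
      by (simp_all add: B_def mat_of_rows_list_def)
    define D where "D = four_block_mat B (0\<^sub>m 2 (n - i - 1)) (0\<^sub>m (n - i - 1) 2) (1\<^sub>m (n - i - 1))"
    have dD: "dim_row D = n - i + 1" "dim_col D = n - i + 1" using i by (auto simp: D_def B)
    have DB: "diag_block_mat [B, 1\<^sub>m (n - i - 1)] = D"
      unfolding diag_block_mat.simps(2)[of B] diag_block_mat_singleton by (simp add: D_def B)
    have gen: "mu_gen k n i = four_block_mat (1\<^sub>m (i - 1)) (0\<^sub>m (i - 1) (n - i + 1))
        (0\<^sub>m (n - i + 1) (i - 1)) D"
      unfolding mu_gen_def B_def[symmetric] diag_block_mat.simps(2)[of "1\<^sub>m (i - 1)"] DB
      by (simp add: dD)
    have iD: "D $$ (p, q) = (if p < 2 then if q < 2 then B $$ (p, q) else 0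
        else if q < 2 then 0 else if p = q then 1 else 0)"
      if "p < n - i + 1" "q < n - i + 1" for p q
      using that i by (auto simp: D_def B)
    have e: "mu_gen k n i $$ (r, c) = (if r < i - 1 then if c = r then 1 else 0
        else if c < i - 1 then 0 else D $$ (r - (i - 1), c - (i - 1)))"
      unfolding gen using rc i dD by auto
    show "mu_gen k n i $$ (r, c) = monomial_mat n (mu_perm i) (mu_weight k i) $$ (r, c)"
    proof (cases "r < i - 1 \<or> c < i - 1")
      case True
      then show ?thesis using rc i unfolding e
        by (auto simp: monomial_mat_def mu_perm_def mu_weight_def)
    next
      case False
      define p q where "p = r - (i - 1)" and "q = c - (i - 1)"
      have pq: "r = (i - 1) + p" "c = (i - 1) + q" using False by (auto simp: p_def q_def)
      have b: "p < n - i + 1" "q < n - i + 1" using rc pq i by auto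
      have "mu_gen k n i $$ (r, c) = D $$ (p, q)" using False by (simp add: e p_def q_def)
      also have "\<dots> = (if q = (if p = 0 then 1 else if p = 1 then 0 else p)
          then (if p = 0 then tpow k else if p = 1 then tpow (- k) else 1) else 0)"
        unfolding iD[OF b] by (auto simp: B less_2_cases_iff)
      also have "\<dots> = monomial_mat n (mu_perm i) (mu_weight k i) $$ (r, c)"
      proof -
        have "(r = i - 1) = (p = 0)" "(r = i) = (p = 1)"
          "(c = i) = (q = 1)" "(c = i - 1) = (q = 0)" "(c = r) = (q = p)"
          using pq i by auto
        then show ?thesis using rc
          by (simp add: monomial_mat_def mu_perm_def mu_weight_def)
      qed
      finally show ?thesis .
    qed
  qed (use i in \<open>auto simp: mu_gen_def monomial_mat_def Let_def mat_of_rows_list_def\<close>)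
qed

lemma mu_perm_less: "i \<in> triplet_gens n \<Longrightarrow> r < n \<Longrightarrow> mu_perm i r < n"
  by (auto simp: triplet_gens_def mu_perm_def)

lemma tpow_cancel [simp]: "tpow k * tpow (- k) = 1" "tpow (- k) * tpow k = 1"
  by (simp_all flip: tpow_add add: tpow_0)

lemma mu_gen_square:
  assumes "i \<in> triplet_gens n"
  shows "mu_gen k n i * mu_gen k n i = 1\<^sub>m n"
  unfolding mu_gen_monomial[OF assms] one_mat_monomial
  by (subst monomial_mat_mult)
    (use assms in \<open>auto intro!: monomial_mat_cong simp: mu_perm_less, 
      auto simp: triplet_gens_def mu_perm_def mu_weight_def\<close>)

lemma mu_gen_braid:
  assumes "i \<in> triplet_gens n" "i + 1 \<in> triplet_gens n"
  shows "mu_gen k n i * (mu_gen k n (i + 1) * mu_gen k n i) =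
    mu_gen k n (i + 1) * (mu_gen k n i * mu_gen k n (i + 1))"
  unfolding assms[THEN mu_gen_monomial]
  apply (simp add: monomial_mat_mult assms[THEN mu_perm_less] del: One_nat_def)
  apply (rule monomial_mat_cong)
  using assms by (auto simp: triplet_gens_def mu_perm_def mu_weight_def mult.commute)

lemma mu_gen_closed: "mu_gen k n \<in> triplet_gens n \<rightarrow> carrier (GL_laurent n)"
proof
  fix i assume i: "i \<in> triplet_gens n"
  then have "mu_gen k n i \<in> carrier_mat n n"
    by (simp add: mu_gen_monomial) (simp add: monomial_mat_def)
  then show "mu_gen k n i \<in> carrier (GL_laurent n)"
    using mu_gen_square[OF i, of k]
    by (auto simp: GL_laurent_def units_of_def Units_def ring_mat_simps)
qed

lemma mu_gen_rels:
  assumes "(u, v) \<in> triplet_rels n"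
  shows "eval_gword (GL_laurent n) (mu_gen k n) u = eval_gword (GL_laurent n) (mu_gen k n) v"
proof -
  have c: "mu_gen k n i \<in> carrier_mat n n" if "i \<in> triplet_gens n" for i
    using that by (simp add: mu_gen_monomial) (simp add: monomial_mat_def)
  have r1: "mu_gen k n i * 1\<^sub>m n = mu_gen k n i" if "i \<in> triplet_gens n" for i
    using c[OF that] by simp
  have sim: "monoid.mult (GL_laurent n) = (*)" "\<one>\<^bsub>GL_laurent n\<^esub> = 1\<^sub>m n"
    by (simp_all add: GL_laurent_def units_of_def ring_mat_simps)
  from assms consider i where "i \<in> triplet_gens n" "u = [(i, True), (i, True)]" "v = []"
    | i where "i \<in> triplet_gens n" "i + 1 \<in> triplet_gens n"
      "u = [(i, True), (i + 1, True), (i, True)]"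
      "v = [(i + 1, True), (i, True), (i + 1, True)]"
    unfolding triplet_rels_def triplet_gens_def by force
  then show ?thesis
  proof cases
    case 1
    then show ?thesis
      by (simp add: eval_gword_def eval_letter_def sim r1 mu_gen_square)
  next
    case 2
    then show ?thesis using mu_gen_braid[of i n k] r1[of i] r1[of "i + 1"]
      by (simp add: eval_gword_def eval_letter_def sim)
  qed
qed

lemma mu'_hom: "mu' k n \<in> hom (triplet_group n) (GL_laurent n)"
  unfolding mu'_def triplet_group_def
  by (rule group.presented_lift_hom[OF group_GL_laurent mu_gen_closed mu_gen_rels])

lemma mu'_gen:
  assumes "1 \<le> i" "i \<le> n - 1"
  shows "mu' k n (triplet_gen n i) = mu_gen k n i"
  unfolding mu'_def triplet_gen_def
  by (rule group.presented_lift_gen[OF group_GL_laurent mu_gen_closed mu_gen_rels])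
    (use assms in \<open>auto simp: triplet_gens_def\<close>)

end

theory Submission
  imports Defs
begin

text \<open>Every \<open>\<mu>'(\<ell>\<^sub>i)\<close> is a monomial matrix whose underlying permutation is the transposition
  \<open>(i-1 i)\<close>, so \<open>\<mu>'\<close> refines the map from the triplet group \<open>L\<^sub>n\<close> to the symmetric group.  For
  \<open>n = 2\<close> and \<open>n = 3\<close> the relations of \<open>L\<^sub>n\<close> leave at most \<open>n!\<close> elements
  (\<open>carrier_triplet_group_2\<close>, \<open>carrier_triplet_group_3\<close>), and each of them other than the identity
  moves some point; since a monomial matrix that moves a point is not the identity
  (\<open>monomial_mat_eq_one_fixes\<close>), the kernel is trivial.

  For \<open>n \<ge> 4\<close> the blocks of \<open>\<ell>\<^sub>1\<close> and \<open>\<ell>\<^sub>3\<close> are disjoint, so their images commute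
  (\<open>mu_gen_commute\<close>).  The elements themselves do not: the only relations that tie different
  generators together are braid relations between neighbours.  These hold between the
  transpositions \<open>(0 1)\<close> and \<open>(1 2)\<close>, and trivially between equal elements, so sending \<open>\<ell>\<^sub>1\<close>
  to \<open>(0 1)\<close> and all other generators to \<open>(1 2)\<close> defines a homomorphism to the symmetric group on
  three points, where \<open>\<ell>\<^sub>1\<close> and \<open>\<ell>\<^sub>3\<close> have noncommuting
  images (\<open>triplet_gen_1_3_noncommuting\<close>).\<close>

section \<open>Triplet groups in low rank\<close>

lemma pres_cong_class_eq:
  "pres_cong S R u v \<Longrightarrow> pres_rel S R `` {u} = pres_rel S R `` {v}"
  by (rule equiv_class_eq[OF equiv_pres_rel]) (simp add: pres_rel_def)

lemma triplet_gen_closed: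
  "i \<in> triplet_gens n \<Longrightarrow> triplet_gen n i \<in> carrier (triplet_group n)"
  by (auto simp: triplet_gen_def presented_gen_def triplet_group_def intro: presented_carrierI)

lemma triplet_gen_square:
  assumes "i \<in> triplet_gens n"
  shows "triplet_gen n i \<otimes>\<^bsub>triplet_group n\<^esub> triplet_gen n i = \<one>\<^bsub>triplet_group n\<^esub>"
proof -
  have "([(i, True), (i, True)], []) \<in> triplet_rels n"
    using assms by (auto simp: triplet_rels_def triplet_gens_def)
  then have "pres_cong (triplet_gens n) (triplet_rels n) [(i, True), (i, True)] []"
    using pres_cong.rel[of "[]" "triplet_gens n" "[]"] assms by simp
  then show ?thesis
    using assms
    by (simp add: triplet_gen_def presented_gen_def triplet_group_def presented_mult presented_one
        pres_cong_class_eq)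
qed

lemma triplet_gen_braid:
  assumes "i \<in> triplet_gens n" "i + 1 \<in> triplet_gens n"
  defines "G \<equiv> triplet_group n"
  shows "triplet_gen n i \<otimes>\<^bsub>G\<^esub> (triplet_gen n (i + 1) \<otimes>\<^bsub>G\<^esub> triplet_gen n i) =
    triplet_gen n (i + 1) \<otimes>\<^bsub>G\<^esub> (triplet_gen n i \<otimes>\<^bsub>G\<^esub> triplet_gen n (i + 1))"
proof -
  have "([(i, True), (i + 1, True), (i, True)], [(i + 1, True), (i, True), (i + 1, True)])
      \<in> triplet_rels n"
    using assms(1,2) by (auto simp: triplet_rels_def triplet_gens_def)
  then have "pres_cong (triplet_gens n) (triplet_rels n)
      [(i, True), (i + 1, True), (i, True)] [(i + 1, True), (i, True), (i + 1, True)]"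
    using pres_cong.rel[of "[]" "triplet_gens n" "[]"] assms by simp
  then show ?thesis
    using assms(1,2)
    by (simp add: G_def triplet_gen_def presented_gen_def triplet_group_def presented_mult
        pres_cong_class_eq)
qed

text \<open>The generators are involutions, hence generate \<open>L\<^sub>n\<close> as a monoid: inverse letters need no
  case of their own.\<close>

lemma triplet_group_induct [consumes 1, case_names one gen]:
  assumes "A \<in> carrier (triplet_group n)"
    and one: "P \<one>\<^bsub>triplet_group n\<^esub>"
    and gen: "\<And>i A. i \<in> triplet_gens n \<Longrightarrow> A \<in> carrier (triplet_group n) \<Longrightarrow> P A \<Longrightarrow>
      P (triplet_gen n i \<otimes>\<^bsub>triplet_group n\<^esub> A)"
  shows "P A"
proof -
  let ?S = "triplet_gens n" and ?R = "triplet_rels n"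
  let ?cl = "\<lambda>u. pres_rel ?S ?R `` {u}"
  interpret G: group "triplet_group n" by (rule group_triplet_group)
  have letter: "?cl [(i, b)] = triplet_gen n i" if i: "i \<in> ?S" for i b
  proof (cases b)
    case False
    have c: "?cl [(i, False)] \<in> carrier (triplet_group n)"
      using i by (auto simp: triplet_group_def intro: presented_carrierI)
    have "pres_cong ?S ?R [(i, False), (i, True)] []"
      using pres_cong.cancel[of "[]" ?S "[]" i ?R False] i by simp
    then have "?cl [(i, False)] \<otimes>\<^bsub>triplet_group n\<^esub> triplet_gen n i = \<one>\<^bsub>triplet_group n\<^esub>"
      using i
      by (simp add: triplet_gen_def presented_gen_def triplet_group_def presented_mult
          presented_one pres_cong_class_eq)
    then show ?thesis
      using False triplet_gen_square[OF i] triplet_gen_closed[OF i] c G.right_cancel by metis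
  qed (simp add: triplet_gen_def presented_gen_def)
  have "P (?cl u)" if "u \<in> gwords ?S" for u
    using that
  proof (induction u)
    case Nil
    then show ?case using one by (simp add: triplet_group_def presented_one)
  next
    case (Cons l u)
    obtain i b where l: "l = (i, b)" by (cases l)
    have "?cl (l # u) = triplet_gen n i \<otimes>\<^bsub>triplet_group n\<^esub> ?cl u"
      using Cons.prems letter[of i b] presented_mult[of "[l]" ?S u ?R]
      by (simp add: l triplet_group_def)
    moreover have "?cl u \<in> carrier (triplet_group n)"
      using Cons.prems by (auto simp: triplet_group_def intro: presented_carrierI)
    ultimately show ?case using Cons gen[of i "?cl u"] by (simp add: l)
  qed
  then show ?thesis
    using assms(1) by (auto simp: triplet_group_def elim!: presented_carrierE)
qed

lemma carrier_triplet_group_2: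
  "carrier (triplet_group 2) \<subseteq> {\<one>\<^bsub>triplet_group 2\<^esub>, triplet_gen 2 1}"
proof
  fix A assume "A \<in> carrier (triplet_group 2)"
  then show "A \<in> {\<one>\<^bsub>triplet_group 2\<^esub>, triplet_gen 2 1}"
  proof (induction rule: triplet_group_induct)
    case (gen i A)
    interpret G: group "triplet_group 2" by (rule group_triplet_group)
    have "i = 1" using gen(1) by (auto simp: triplet_gens_def)
    with gen triplet_gen_square[of i 2] triplet_gen_closed[of i 2] show ?case by auto
  qed simp
qed

text \<open>The six words are closed under left multiplication by both generators: \<open>a\<^sup>2 = b\<^sup>2 = 1\<close>
  shortens a word beginning with the new letter, and \<open>bab = aba\<close> covers the rest.\<close>

lemma carrier_triplet_group_3:
  defines "G \<equiv> triplet_group 3" and "a \<equiv> triplet_gen 3 1" and "b \<equiv> triplet_gen 3 2"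
  shows "carrier G \<subseteq>
    {\<one>\<^bsub>G\<^esub>, a, b, a \<otimes>\<^bsub>G\<^esub> b, b \<otimes>\<^bsub>G\<^esub> a, a \<otimes>\<^bsub>G\<^esub> (b \<otimes>\<^bsub>G\<^esub> a)}" (is "_ \<subseteq> ?N")
proof
  interpret G: group G unfolding G_def by (rule group_triplet_group)
  have g: "1 \<in> triplet_gens 3" "2 \<in> triplet_gens 3" by (auto simp: triplet_gens_def)
  have c [simp]: "a \<in> carrier G" "b \<in> carrier G"
    using g by (auto simp: G_def a_def b_def triplet_gen_closed)
  have sq: "a \<otimes>\<^bsub>G\<^esub> a = \<one>\<^bsub>G\<^esub>" "b \<otimes>\<^bsub>G\<^esub> b = \<one>\<^bsub>G\<^esub>"
    using g by (auto simp: G_def a_def b_def triplet_gen_square)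
  have sq': "a \<otimes>\<^bsub>G\<^esub> (a \<otimes>\<^bsub>G\<^esub> x) = x" "b \<otimes>\<^bsub>G\<^esub> (b \<otimes>\<^bsub>G\<^esub> x) = x" if "x \<in> carrier G" for x
    using that sq by (simp_all flip: G.m_assoc)
  have br: "b \<otimes>\<^bsub>G\<^esub> (a \<otimes>\<^bsub>G\<^esub> b) = a \<otimes>\<^bsub>G\<^esub> (b \<otimes>\<^bsub>G\<^esub> a)"
    using triplet_gen_braid[of 1 3] g by (simp add: G_def a_def b_def numeral_2_eq_2)
  have br': "b \<otimes>\<^bsub>G\<^esub> (a \<otimes>\<^bsub>G\<^esub> (b \<otimes>\<^bsub>G\<^esub> a)) = a \<otimes>\<^bsub>G\<^esub> b"
    using sq'(2)[of "a \<otimes>\<^bsub>G\<^esub> b"] by (simp add: br)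
  fix A assume "A \<in> carrier G"
  then show "A \<in> ?N"
    unfolding G_def
  proof (induction rule: triplet_group_induct)
    case (gen i A)
    have "i = 1 \<or> i = 2" using gen(1) by (auto simp: triplet_gens_def)
    then have "triplet_gen 3 i = a \<or> triplet_gen 3 i = b" by (auto simp: a_def b_def)
    then show ?case
      using gen(3) unfolding G_def[symmetric]
      by (elim insertE emptyE disjE; simp add: sq sq' br br')
  qed simp
qed

section \<open>Comparing monomial matrices\<close>

lemma monomial_mat_eqD:
  assumes "monomial_mat n s w = monomial_mat n s' w'" "r < n" "s r < n" "w r \<noteq> 0"
  shows "s' r = s r"
proof -
  have "monomial_mat n s w $$ (r, s r) = monomial_mat n s' w' $$ (r, s r)"
    using assms(1) by simp
  then show ?thesis using assms(2-4) by (auto simp: monomial_mat_def split: if_splits)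
qed

lemma monomial_mat_eq_one_fixes:
  fixes w :: "nat \<Rightarrow> 'a :: comm_ring_1"
  assumes "monomial_mat n s w = 1\<^sub>m n" "r < n"
  shows "s r = r"
  using monomial_mat_eqD[of n id "\<lambda>_. 1 :: 'a" s w r] assms by (simp add: one_mat_monomial)

lemma GL_laurent_mult_one:
  "x \<otimes>\<^bsub>GL_laurent n\<^esub> y = x * y" "\<one>\<^bsub>GL_laurent n\<^esub> = 1\<^sub>m n"
  by (simp_all add: GL_laurent_def units_of_def ring_mat_simps)

section \<open>Faithfulness in ranks two and three\<close>

lemma group_hom_mu': "group_hom (triplet_group n) (GL_laurent n) (mu' k n)"
  by (intro group_hom.intro group_hom_axioms.intro group_triplet_group group_GL_laurent mu'_hom)

lemma faithful_mu'I:
  assumes "\<And>A. A \<in> carrier (triplet_group n) \<Longrightarrow> mu' k n A = 1\<^sub>m n \<Longrightarrow> A = \<one>\<^bsub>triplet_group n\<^esub>"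
  shows "faithful (triplet_group n) (mu' k n)"
  unfolding faithful_def
  using assms group_hom.inj_on_one_iff[OF group_hom_mu'[of n k]] by (simp add: GL_laurent_mult_one)

lemma faithful_mu'_2: "faithful (triplet_group 2) (mu' k 2)"
proof (rule faithful_mu'I)
  fix A assume "A \<in> carrier (triplet_group 2)" and one: "mu' k 2 A = 1\<^sub>m 2"
  then consider "A = \<one>\<^bsub>triplet_group 2\<^esub>" | "A = triplet_gen 2 1"
    using carrier_triplet_group_2 by blast
  then show "A = \<one>\<^bsub>triplet_group 2\<^esub>"
  proof cases
    case 2
    then have "monomial_mat 2 (mu_perm 1) (mu_weight k 1) = 1\<^sub>m 2"
      using one mu'_gen[of 1 2 k] mu_gen_monomial[of 1 2 k] by (simp add: triplet_gens_def)
    from monomial_mat_eq_one_fixes[OF this, of 0] show ?thesis by (simp add: mu_perm_def)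
  qed
qed

lemma faithful_mu'_3: "faithful (triplet_group 3) (mu' k 3)"
proof (rule faithful_mu'I)
  define G a b where "G = triplet_group 3" and "a = triplet_gen 3 1" and "b = triplet_gen 3 2"
  interpret mu: group_hom G "GL_laurent 3" "mu' k 3" unfolding G_def by (rule group_hom_mu')
  have g: "1 \<in> triplet_gens 3" "2 \<in> triplet_gens 3" by (auto simp: triplet_gens_def)
  have c [simp]: "a \<in> carrier G" "b \<in> carrier G"
    using g by (auto simp: G_def a_def b_def triplet_gen_closed)
  have im: "mu' k 3 a = mu_gen k 3 1" "mu' k 3 b = mu_gen k 3 2"
    by (auto simp: a_def b_def mu'_gen)
  note mono = GL_laurent_mult_one im g[THEN mu_gen_monomial] monomial_mat_mult
    g[THEN mu_perm_less]
  fix A assume "A \<in> carrier (triplet_group 3)" and one: "mu' k 3 A = 1\<^sub>m 3"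
  then consider "A = \<one>\<^bsub>G\<^esub>" | "A = a" | "A = b" | "A = a \<otimes>\<^bsub>G\<^esub> b" | "A = b \<otimes>\<^bsub>G\<^esub> a"
    | "A = a \<otimes>\<^bsub>G\<^esub> (b \<otimes>\<^bsub>G\<^esub> a)"
    using carrier_triplet_group_3 unfolding G_def a_def b_def by blast
  then have "A = \<one>\<^bsub>G\<^esub>"
  proof cases
    case 2
    with one show ?thesis
      by (auto simp: mono mu_perm_def simp del: One_nat_def dest!: monomial_mat_eq_one_fixes[where r = 0])
  next
    case 3
    \<comment> \<open>The transposition \<open>(1 2)\<close> fixes \<open>0\<close>, where the other cases are decided.\<close>
    with one show ?thesis
      by (auto simp: mono mu_perm_def simp del: One_nat_def dest!: monomial_mat_eq_one_fixes[where r = 2])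
  next
    case 4
    with one show ?thesis
      by (auto simp: mono mu_perm_def simp del: One_nat_def dest!: monomial_mat_eq_one_fixes[where r = 0])
  next
    case 5
    with one show ?thesis
      by (auto simp: mono mu_perm_def simp del: One_nat_def dest!: monomial_mat_eq_one_fixes[where r = 0])
  next
    case 6
    with one show ?thesis
      by (auto simp: mono mu_perm_def simp del: One_nat_def dest!: monomial_mat_eq_one_fixes[where r = 0])
  qed
  then show "A = \<one>\<^bsub>triplet_group 3\<^esub>" by (simp add: G_def)
qed

section \<open>Failure of faithfulness in higher rank\<close>

lemma mu_gen_commute:
  assumes "i \<in> triplet_gens n" "j \<in> triplet_gens n" "i + 1 < j"
  shows "mu_gen k n i * mu_gen k n j = mu_gen k n j * mu_gen k n i"
proof -
  obtain p where i: "i = Suc p"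
    using assms(1) by (cases i) (auto simp: triplet_gens_def)
  obtain q where j: "j = Suc q" "Suc p < q"
    using assms(3) i by (cases j) auto
  have comm: "(mu_perm j \<circ> mu_perm i) r = (mu_perm i \<circ> mu_perm j) r \<and>
      mu_weight k i r * mu_weight k j (mu_perm i r) =
      mu_weight k j r * mu_weight k i (mu_perm j r)" for r
  proof -
    consider "r = p" | "r = Suc p" | "r = q" | "r = Suc q" | "r \<notin> {p, Suc p, q, Suc q}" by auto
    then show ?thesis
      unfolding i j(1) using j(2) by cases (simp_all add: mu_perm_def mu_weight_def)
  qed
  have mult: "monomial_mat n (mu_perm l) w * monomial_mat n s v =
      monomial_mat n (s \<circ> mu_perm l) (\<lambda>r. w r * v (mu_perm l r))"
    if "l \<in> triplet_gens n" for l s and w v :: "nat \<Rightarrow> laurent"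
    by (rule monomial_mat_mult) (rule mu_perm_less[OF that])
  show ?thesis
    unfolding assms(1,2)[THEN mu_gen_monomial] assms(1,2)[THEN mult]
    by (rule monomial_mat_cong) (rule comm[THEN conjunct1], rule comm[THEN conjunct2])
qed

text \<open>The distinguishing homomorphism takes its values among the \<open>3 \<times> 3\<close> permutation matrices, as
  which the matrices of the representation appear for \<open>k = 0\<close>.\<close>

lemma triplet_gen_1_3_noncommuting:
  assumes "n \<ge> 4"
  shows "triplet_gen n 1 \<otimes>\<^bsub>triplet_group n\<^esub> triplet_gen n 3 \<noteq>
    triplet_gen n 3 \<otimes>\<^bsub>triplet_group n\<^esub> triplet_gen n 1"
proof
  assume eq: "triplet_gen n 1 \<otimes>\<^bsub>triplet_group n\<^esub> triplet_gen n 3 =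
    triplet_gen n 3 \<otimes>\<^bsub>triplet_group n\<^esub> triplet_gen n 1"
  define f where "f i = mu_gen 0 3 (if i = 1 then 1 else 2)" for i :: nat
  define h where "h = presented_lift (GL_laurent 3) f"
  have g: "1 \<in> triplet_gens 3" "2 \<in> triplet_gens 3" by (auto simp: triplet_gens_def)
  interpret M: group "GL_laurent 3" by (rule group_GL_laurent)
  have fc: "f i \<in> carrier (GL_laurent 3)" for i
    using mu_gen_closed[of 0 3] g by (auto simp: f_def)
  then have f: "f \<in> triplet_gens n \<rightarrow> carrier (GL_laurent 3)" by blast
  have sq: "f i * f i = 1\<^sub>m 3" for i
    using g by (auto simp: f_def mu_gen_square)
  have braid: "f i * (f (i + 1) * f i) = f (i + 1) * (f i * f (i + 1))" if "1 \<le> i" for i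
    using mu_gen_braid[of 1 3 0] g that by (cases "i = 1") (auto simp: f_def numeral_2_eq_2)
  have r1: "f i * 1\<^sub>m 3 = f i" for i
    using M.r_one[OF fc, of i] by (simp add: GL_laurent_mult_one)
  have R: "eval_gword (GL_laurent 3) f u = eval_gword (GL_laurent 3) f v"
    if "(u, v) \<in> triplet_rels n" for u v
    using that sq braid
    by (auto simp: triplet_rels_def eval_gword_def eval_letter_def GL_laurent_mult_one r1)
  have h: "h \<in> hom (triplet_group n) (GL_laurent 3)"
    unfolding h_def triplet_group_def by (rule M.presented_lift_hom[OF f R])
  have hg: "h (triplet_gen n i) = f i" if "i \<in> triplet_gens n" for i
    unfolding h_def triplet_gen_def by (rule M.presented_lift_gen[OF f R that])
  have "1 \<in> triplet_gens n" "3 \<in> triplet_gens n"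
    using assms by (auto simp: triplet_gens_def)
  then have "f 1 * f 3 = f 3 * f 1"
    using arg_cong[OF eq, of h]
    by (simp add: hom_mult[OF h] triplet_gen_closed hg GL_laurent_mult_one)
  then have "monomial_mat 3 (mu_perm 2 \<circ> mu_perm 1)
        (\<lambda>r. mu_weight 0 1 r * mu_weight 0 2 (mu_perm 1 r)) =
      monomial_mat 3 (mu_perm 1 \<circ> mu_perm 2)
        (\<lambda>r. mu_weight 0 2 r * mu_weight 0 1 (mu_perm 2 r))"
    using g by (simp add: f_def mu_gen_monomial monomial_mat_mult mu_perm_less)
  \<comment> \<open>The two composites send \<open>0\<close> to \<open>2\<close> and to \<open>1\<close>.\<close>
  from monomial_mat_eqD[OF this, of 0] show False
    by (simp add: mu_perm_def mu_weight_def tpow_0)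
qed

lemma not_faithful_mu':
  assumes "n \<ge> 4"
  shows "\<not> faithful (triplet_group n) (mu' k n)"
proof
  assume "faithful (triplet_group n) (mu' k n)"
  then have inj: "inj_on (mu' k n) (carrier (triplet_group n))" by (simp add: faithful_def)
  interpret mu: group_hom "triplet_group n" "GL_laurent n" "mu' k n" by (rule group_hom_mu')
  have g: "1 \<in> triplet_gens n" "3 \<in> triplet_gens n"
    using assms by (auto simp: triplet_gens_def)
  note c = g[THEN triplet_gen_closed]
  have "mu' k n (triplet_gen n 1 \<otimes>\<^bsub>triplet_group n\<^esub> triplet_gen n 3) =
      mu' k n (triplet_gen n 3 \<otimes>\<^bsub>triplet_group n\<^esub> triplet_gen n 1)"
    using c g assms mu_gen_commute[OF g, of k] by (simp add: GL_laurent_mult_one mu'_gen)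
  from inj_onD[OF inj this] c
  have "triplet_gen n 1 \<otimes>\<^bsub>triplet_group n\<^esub> triplet_gen n 3 =
      triplet_gen n 3 \<otimes>\<^bsub>triplet_group n\<^esub> triplet_gen n 1"
    by (simp add: mu.G.m_closed)
  with triplet_gen_1_3_noncommuting[OF assms] show False by contradiction
qed

theorem theorem15:
  fixes k :: int
  shows "faithful (triplet_group 2) (mu' k 2) \<and>
         faithful (triplet_group 3) (mu' k 3) \<and>
         (\<forall>n\<ge>4. \<not> faithful (triplet_group n) (mu' k n))"
  using faithful_mu'_2 faithful_mu'_3 not_faithful_mu' by blast

end
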